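(* Let $(X,T)$ be a minimal topological dynamical system and let $\pi: X\to X_{eq}$ be the factor map onto its maximal equicontinuous factor. Then the following conditions are equivalent: (1) $(X,T)$ is block $\mathcal{F}_t$-sensitive; (2) there exists $\delta>0$ such that for every $x\in X$ there exists $y\in X$ such that $(x,y)$ is regionally proximal and $\inf_{n\in\mathbb{Z}_+} d(T^nx,T^ny)>\delta$; (3) $\pi: X\to X_{eq}$ is not proximal.
   Context: A topological dynamical system $(X,T)$ consists of a compact metric space $(X,d)$ and a continuous surjection $T:X\to X$; it is minimal if every orbit is dense. $(X,T)$ is block $\mathcal{F}_t$-sensitive if there is $\delta>0$ such that for each $x\in X$, every neighborhood $U$ of $x$ and every $l\in\mathbb{N}$ there is $y_l\in U$ such that $\{n\in\mathbb{Z}_+: d(T^nx,T^ny_l)>\delta\}$ contains $\{m+1,\dots,m+l\}$ for some $m\in\mathbb{N}$. A pair $(x_1,x_2)$ is regionally proximal if for each $\varepsilon>0$ and neighborhoods $U_i$ of $x_i$ there are $x_i'\in U_i$ and $n\in\mathbb{N}$ with $d(T^nx_1',T^nx_2')<\varepsilon$. A pair $(x,y)$ is proximal if $\inf_{n} d(T^nx,T^ny)=0$. The maximal equicontinuous factor $X_{eq}$ is the equicontinuous factor of $(X,T)$ of which every equicontinuous factor is a factor. A factor map $\pi$ is proximal if every pair $(x,y)$ with $\pi(x)=\pi(y)$ is proximal. *)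

theory Defs
  imports "HOL-Analysis.Analysis"
begin

definition tds :: "'a::metric_space set \<Rightarrow> ('a \<Rightarrow> 'a) \<Rightarrow> bool" where
  "tds X T \<longleftrightarrow> X \<noteq> {} \<and> compact X \<and> continuous_on X T \<and> T ` X = X"

definition minimal_tds :: "'a::metric_space set \<Rightarrow> ('a \<Rightarrow> 'a) \<Rightarrow> bool" where
  "minimal_tds X T \<longleftrightarrow> tds X T \<and> (\<forall>x\<in>X. closure {(T ^^ n) x | n. True} = X)"

definition equicontinuous_tds :: "'a::metric_space set \<Rightarrow> ('a \<Rightarrow> 'a) \<Rightarrow> bool" where
  "equicontinuous_tds Y S \<longleftrightarrow> tds Y S \<and>
     (\<forall>e>0. \<exists>d>0. \<forall>y1\<in>Y. \<forall>y2\<in>Y. dist y1 y2 < d \<longrightarrow>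
        (\<forall>n. dist ((S ^^ n) y1) ((S ^^ n) y2) < e))"

definition factor_map :: "'a::metric_space set \<Rightarrow> ('a \<Rightarrow> 'a) \<Rightarrow> 'b::metric_space set \<Rightarrow> ('b \<Rightarrow> 'b)
     \<Rightarrow> ('a \<Rightarrow> 'b) \<Rightarrow> bool" where
  "factor_map X T Y S \<pi> \<longleftrightarrow> tds X T \<and> tds Y S \<and> continuous_on X \<pi> \<and> \<pi> ` X = Y \<and>
     (\<forall>x\<in>X. \<pi> (T x) = S (\<pi> x))"

text \<open>Maximal equicontinuous factor. Every compact metric space embeds homeomorphically in the
Hilbert cube inside nat => real (product topology, metric from Function_Metric), so quantifying
over equicontinuous factors living in nat => real covers all equicontinuous factors up to
isomorphism.\<close>
definition max_equicontinuous_factor :: "'a::metric_space set \<Rightarrow> ('a \<Rightarrow> 'a) \<Rightarrow> 'b::metric_space set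
     \<Rightarrow> ('b \<Rightarrow> 'b) \<Rightarrow> ('a \<Rightarrow> 'b) \<Rightarrow> bool" where
  "max_equicontinuous_factor X T Y S \<pi> \<longleftrightarrow> factor_map X T Y S \<pi> \<and> equicontinuous_tds Y S \<and>
     (\<forall>(Z :: (nat \<Rightarrow> real) set) R \<psi>. factor_map X T Z R \<psi> \<and> equicontinuous_tds Z R \<longrightarrow>
        (\<exists>\<phi>. factor_map Y S Z R \<phi> \<and> (\<forall>x\<in>X. \<psi> x = \<phi> (\<pi> x))))"

definition block_Ft_sensitive :: "'a::metric_space set \<Rightarrow> ('a \<Rightarrow> 'a) \<Rightarrow> bool" where
  "block_Ft_sensitive X T \<longleftrightarrow> (\<exists>\<delta>>0. \<forall>x\<in>X. \<forall>U. openin (top_of_set X) U \<and> x \<in> U \<longrightarrow>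
     (\<forall>l::nat. l \<ge> 1 \<longrightarrow> (\<exists>y\<in>U. \<exists>m::nat. m \<ge> 1 \<and>
        {m+1..m+l} \<subseteq> {n. dist ((T ^^ n) x) ((T ^^ n) y) > \<delta>})))"

definition regionally_proximal :: "'a::metric_space set \<Rightarrow> ('a \<Rightarrow> 'a) \<Rightarrow> 'a \<Rightarrow> 'a \<Rightarrow> bool" where
  "regionally_proximal X T x1 x2 \<longleftrightarrow> (\<forall>e>0. \<forall>U1 U2. openin (top_of_set X) U1 \<and> x1 \<in> U1 \<and>
     openin (top_of_set X) U2 \<and> x2 \<in> U2 \<longrightarrow>
     (\<exists>x1'\<in>U1. \<exists>x2'\<in>U2. \<exists>n::nat. n \<ge> 1 \<and> dist ((T ^^ n) x1') ((T ^^ n) x2') < e))"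

definition proximal :: "('a::metric_space \<Rightarrow> 'a) \<Rightarrow> 'a \<Rightarrow> 'a \<Rightarrow> bool" where
  "proximal T x y \<longleftrightarrow> (INF n. dist ((T ^^ n) x) ((T ^^ n) y)) = 0"

definition proximal_factor_map :: "'a::metric_space set \<Rightarrow> ('a \<Rightarrow> 'a) \<Rightarrow> ('a \<Rightarrow> 'b) \<Rightarrow> bool" where
  "proximal_factor_map X T \<pi> \<longleftrightarrow> (\<forall>x\<in>X. \<forall>y\<in>X. \<pi> x = \<pi> y \<longrightarrow> proximal T x y)"

end

theory Submission
  imports Defs
begin

text \<open>The fibres of \<open>\<pi>\<close> are controlled by an argument of McMahon. Fix a finitely additive
\<open>T\<close>-invariant mean and its outer regularisation \<open>\<mu>\<close>. If \<open>N \<subseteq> X \<times> X\<close> is closed and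
forward invariant, then \<open>\<mu>\<close> of the sections \<open>N `` {x}\<close> is upper semicontinuous and does not
decrease along orbits, hence is constant by minimality; so
\<open>\<mu> (N `` {x} \<union> N `` {y}) - \<mu> (N `` {x})\<close> is a continuous pseudometric that \<open>T\<close> does not expand.
Its quotient is an equicontinuous factor, and therefore it vanishes whenever \<open>\<pi> x = \<pi> y\<close>: an open
set contained in \<open>N `` {x}\<close> must then meet \<open>N `` {y}\<close>.

Taking for \<open>N\<close> the pairs whose iterates stay \<open>e\<close>-apart shows that fibres of \<open>\<pi>\<close> are regionally
proximal. Taking for \<open>N\<close> the orbit closure of \<open>{x} \<times> U\<close> moves, by one and the same iterate, \<open>x\<close>
close to any \<open>y\<close> in its fibre and some point of \<open>U\<close> close to \<open>x\<close>; for a non-proximal pair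
\<open>(x, y)\<close> this yields block sensitivity. Conversely, the pairs of iterates along longer and longer
blocks accumulate at a non-proximal pair in a fibre of \<open>\<pi>\<close>.\<close>

subsection \<open>An invariant mean\<close>


lemma compact_unit_cube: "compact {f :: 'i \<Rightarrow> real. \<forall>i. f i \<in> {0..1}}"
proof -
  have "compactin (product_topology (\<lambda>_. euclidean) UNIV) (PiE UNIV (\<lambda>_::'i. {0..1::real}))"
    by (simp add: compactin_PiE)
  moreover have "PiE UNIV (\<lambda>_::'i. {0..1::real}) = {f. \<forall>i. f i \<in> {0..1}}"
    by (auto simp: PiE_def Pi_def)
  ultimately show ?thesis by (simp add: euclidean_product_topology)
qed

text \<open>Such a mean is a cluster point of the orbit averages in the compact cube of all
functions from sets to the unit interval.\<close>
lemma invariant_mean: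
  fixes T :: "'a \<Rightarrow> 'a" and x0 :: 'a
  obtains \<nu> :: "'a set \<Rightarrow> real" where
    "\<And>A. 0 \<le> \<nu> A" "\<nu> {} = 0" "\<And>A B. \<nu> (A \<union> B) + \<nu> (A \<inter> B) = \<nu> A + \<nu> B"
    "\<And>A. \<nu> (T -` A) = \<nu> A" "\<And>A. (\<And>n. (T ^^ n) x0 \<in> A) \<Longrightarrow> \<nu> A = 1"
proof -
  define c where "c n A = card {k. k < Suc n \<and> (T ^^ k) x0 \<in> A}" for n A
  \<comment> \<open>Averages run over \<open>Suc n\<close> times, so the denominator is never
    zero.\<close>
  define m where "m n A = real (c n A) / real (Suc n)" for n A
  let ?F = "filtermap m sequentially"
  have c_le: "c n A \<le> Suc n" for n A
    using card_mono[of "{..<Suc n}" "{k. k < Suc n \<and> (T ^^ k) x0 \<in> A}"]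
    by (auto simp: c_def)
  have "eventually (\<lambda>f. f \<in> {f. \<forall>i. f i \<in> {0..1}}) ?F"
    using c_le by (simp add: eventually_filtermap m_def del: of_nat_Suc)
  moreover have "?F \<noteq> bot" by (simp add: filtermap_bot_iff)
  ultimately obtain \<nu> where \<nu>: "\<nu> \<in> {f. \<forall>i. f i \<in> {0..1}}" "inf (nhds \<nu>) ?F \<noteq> bot"
    using compact_unit_cube unfolding compact_filter by metis
  \<comment> \<open>A closed condition that eventually holds for the averages passes to the cluster
    point. Each property of the mean below is obtained this way.\<close>
  have lim: "\<nu> \<in> P" if "closed P" "eventually (\<lambda>n. m n \<in> P) sequentially" for P
  proof (rule ccontr)
    assume "\<nu> \<notin> P"
    then have "eventually (\<lambda>f. f \<in> - P) (nhds \<nu>)"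
      using that(1) by (intro eventually_nhds_in_open) auto
    moreover have "eventually (\<lambda>f. f \<in> P) ?F"
      using that(2) by (simp add: eventually_filtermap)
    ultimately have "eventually (\<lambda>f. False) (inf (nhds \<nu>) ?F)"
      unfolding eventually_inf by blast
    with \<nu>(2) show False by (simp add: trivial_limit_def)
  qed
  have cont: "continuous_on UNIV (\<lambda>f. f A :: real)" for A :: "'a set"
    by simp
  have fin: "finite {k. k < Suc n \<and> (T ^^ k) x0 \<in> A}" for n A by simp
  have empty: "\<nu> {} = 0"
  proof -
    have "closed {f :: 'a set \<Rightarrow> real. f {} = 0}"
      by (intro closed_Collect_eq cont continuous_intros)
    from lim[OF this] show ?thesis by (simp add: m_def c_def)
  qed
  have modular: "\<nu> (A \<union> B) + \<nu> (A \<inter> B) = \<nu> A + \<nu> B" for A B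
  proof -
    have "closed {f :: 'a set \<Rightarrow> real. f (A \<union> B) + f (A \<inter> B) = f A + f B}"
      by (intro closed_Collect_eq cont continuous_intros)
    moreover have "m n (A \<union> B) + m n (A \<inter> B) = m n A + m n B" for n
    proof -
      have "{k. k < Suc n \<and> (T ^^ k) x0 \<in> A \<union> B} =
          {k. k < Suc n \<and> (T ^^ k) x0 \<in> A} \<union> {k. k < Suc n \<and> (T ^^ k) x0 \<in> B}"
        "{k. k < Suc n \<and> (T ^^ k) x0 \<in> A \<inter> B} =
          {k. k < Suc n \<and> (T ^^ k) x0 \<in> A} \<inter> {k. k < Suc n \<and> (T ^^ k) x0 \<in> B}"
        by auto
      then have "c n (A \<union> B) + c n (A \<inter> B) = c n A + c n B"
        unfolding c_def using card_Un_Int[OF fin[of n A] fin[of n B]] by simp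
      then have "real (c n (A \<union> B)) + real (c n (A \<inter> B)) = real (c n A) + real (c n B)"
        by (metis of_nat_add)
      then show ?thesis by (simp add: m_def flip: add_divide_distrib)
    qed
    ultimately show ?thesis using lim by fastforce
  qed
  have inv: "\<nu> (T -` A) = \<nu> A" for A
  proof -
    have c_inv: "\<bar>real (c n (T -` A)) - real (c n A)\<bar> \<le> 1" for n
    proof -
      let ?a = "{k. k < Suc n \<and> (T ^^ k) x0 \<in> T -` A}"
      let ?b = "{k. k < Suc n \<and> (T ^^ k) x0 \<in> A}"
      \<comment> \<open>A visit to the preimage at time \<open>k\<close> is a visit to
        \<open>A\<close> at time \<open>Suc k\<close>. Only time \<open>Suc n\<close> can leave the
        window, and conversely only time 0 is missed.\<close>
      have "Suc ` ?a \<subseteq> insert (Suc n) ?b" by auto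
      from card_mono[OF _ this] have "card ?a \<le> Suc (card ?b)"
        using card_insert_le_m1[of "Suc (card ?b)" ?b "Suc n"]
        by (simp add: card_image card_insert_if split: if_splits)
      moreover have "?b \<subseteq> insert 0 (Suc ` ?a)"
      proof
        fix k assume "k \<in> ?b" then show "k \<in> insert 0 (Suc ` ?a)"
          by (cases k) (auto intro!: image_eqI)
      qed
      from card_mono[OF _ this] have "card ?b \<le> Suc (card ?a)"
        by (simp add: card_image card_insert_if)
      ultimately show ?thesis unfolding c_def by linarith
    qed
    have "\<bar>\<nu> (T -` A) - \<nu> A\<bar> \<le> 1 / real (Suc N)" for N
    proof -
      have "closed {f :: 'a set \<Rightarrow> real. \<bar>f (T -` A) - f A\<bar> \<le> 1 / real (Suc N)}"
        by (intro closed_Collect_le cont continuous_intros)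
      moreover have "\<bar>m n (T -` A) - m n A\<bar> \<le> 1 / real (Suc N)" if "N \<le> n" for n
      proof -
        have "\<bar>m n (T -` A) - m n A\<bar> = \<bar>real (c n (T -` A)) - real (c n A)\<bar> / real (Suc n)"
          by (simp add: m_def flip: diff_divide_distrib)
        also have "\<dots> \<le> 1 / real (Suc N)"
          using c_inv[of n] that by (intro frac_le) auto
        finally show ?thesis .
      qed
      ultimately show ?thesis
        using lim[of "{f. \<bar>f (T -` A) - f A\<bar> \<le> 1 / real (Suc N)}"]
        by (auto simp: eventually_sequentially)
    qed
    then have "\<bar>\<nu> (T -` A) - \<nu> A\<bar> \<le> 0"
      by (metis LIMSEQ_inverse_real_of_nat LIMSEQ_le_const inverse_eq_divide)
    then show ?thesis by simp
  qed
  have full: "\<nu> A = 1" if "\<And>n. (T ^^ n) x0 \<in> A" for A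
  proof -
    have "closed {f :: 'a set \<Rightarrow> real. f A = 1}"
      by (intro closed_Collect_eq cont continuous_intros)
    from lim[OF this] show ?thesis using that by (simp add: m_def c_def)
  qed
  show thesis using that \<nu>(1) empty modular inv full by auto
qed

section \<open>Iterates and closed invariant sets\<close>

lemma funpow_mem:
  assumes "T ` X \<subseteq> X" "x \<in> X" shows "(T ^^ n) x \<in> X"
  using assms by (induction n) auto

lemma continuous_on_funpow:
  assumes "continuous_on X T" "T ` X \<subseteq> X" shows "continuous_on X (T ^^ n)"
proof (induction n)
  case (Suc n)
  have "continuous_on ((T ^^ n) ` X) T"
    using assms funpow_mem[OF assms(2)] by (blast intro: continuous_on_subset)
  with continuous_on_compose[OF Suc] show ?case by (simp add: comp_def)
qed auto

text \<open>A closed forward invariant set contains the orbit closures of its points. The lemma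
  spreads a closed invariant property from one point to all of \<open>X\<close>.\<close>

lemma minimal_closed_invariant:
  assumes "minimal_tds X T" "closed K" "K \<subseteq> X" "K \<noteq> {}" "T ` K \<subseteq> K"
  shows "K = X"
proof -
  obtain x where x: "x \<in> K" using assms(4) by auto
  have "{(T ^^ n) x | n. True} \<subseteq> K" using funpow_mem[OF assms(5) x] by auto
  then have "closure {(T ^^ n) x | n. True} \<subseteq> K" by (rule closure_minimal[OF _ assms(2)])
  moreover have "closure {(T ^^ n) x | n. True} = X"
    using assms(1,3) x by (auto simp: minimal_tds_def)
  ultimately show ?thesis using assms(3) by auto
qed

subsection \<open>Sections of closed invariant relations\<close>


text \<open>The mean is defined on all sets of the type, and \<open>T\<close> is arbitrary off
  \<open>X\<close>. By \<open>restrict\<close> only the part inside \<open>X\<close> counts, so full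
  preimages may be exchanged with preimages in \<open>X\<close>.\<close>

locale minimal_mean =
  fixes X :: "'a::metric_space set" and T :: "'a \<Rightarrow> 'a" and \<nu> :: "'a set \<Rightarrow> real"
  assumes minimal: "minimal_tds X T"
    and nonneg: "0 \<le> \<nu> A"
    and empty: "\<nu> {} = 0"
    and modular: "\<nu> (A \<union> B) + \<nu> (A \<inter> B) = \<nu> A + \<nu> B"
    and invariant: "\<nu> (T -` A) = \<nu> A"
    and restrict: "\<nu> (A \<inter> X) = \<nu> A"
    and total: "\<nu> X = 1"
begin

text \<open>Approximation from outside by relatively open sets makes the value on sections of a
  closed relation upper semicontinuous, which \<open>\<nu>\<close>, being only finitely additive,
  need not provide.\<close>

definition \<mu> :: "'a set \<Rightarrow> real" where
  "\<mu> F = Inf {\<nu> V | V. openin (top_of_set X) V \<and> F \<subseteq> V}"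

lemma compact_X: "compact X" and cont_T: "continuous_on X T" and image_T: "T ` X = X"
  using minimal by (auto simp: minimal_tds_def tds_def)

lemma \<nu>_disjoint: "A \<inter> B = {} \<Longrightarrow> \<nu> (A \<union> B) = \<nu> A + \<nu> B"
  using modular[of A B] empty by simp

lemma \<nu>_mono: assumes "A \<subseteq> B" shows "\<nu> A \<le> \<nu> B"
proof -
  have "\<nu> (A \<union> (B - A)) = \<nu> A + \<nu> (B - A)" by (rule \<nu>_disjoint) auto
  moreover have "A \<union> (B - A) = B" using assms by auto
  ultimately show ?thesis using nonneg[of "B - A"] by simp
qed

lemma \<nu>_preimage: "\<nu> {x \<in> X. T x \<in> A} = \<nu> A"
proof -
  have "{x \<in> X. T x \<in> A} = T -` A \<inter> X" by auto
  then show ?thesis using restrict[of "T -` A"] invariant[of A] by simp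
qed

lemma \<mu>_le: "openin (top_of_set X) V \<Longrightarrow> F \<subseteq> V \<Longrightarrow> \<mu> F \<le> \<nu> V"
  unfolding \<mu>_def by (intro cInf_lower bdd_belowI[of _ 0]) (auto simp: nonneg)

lemma \<mu>_greatest:
  assumes "F \<subseteq> X" "\<And>V. openin (top_of_set X) V \<Longrightarrow> F \<subseteq> V \<Longrightarrow> c \<le> \<nu> V"
  shows "c \<le> \<mu> F"
  unfolding \<mu>_def by (rule cInf_greatest) (use assms in auto)

lemma \<mu>_lessE:
  assumes "F \<subseteq> X" "\<mu> F < c"
  obtains V where "openin (top_of_set X) V" "F \<subseteq> V" "\<nu> V < c"
  using \<mu>_greatest[OF assms(1), of c] assms(2) that by force

lemma \<mu>_mono: "F \<subseteq> G \<Longrightarrow> G \<subseteq> X \<Longrightarrow> \<mu> F \<le> \<mu> G"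
  by (rule \<mu>_greatest) (auto intro: \<mu>_le)

text \<open>Near-optimal open supersets of \<open>F\<close> and \<open>G\<close> have open union and
  intersection, to which the modular law of \<open>\<nu>\<close> applies.\<close>

lemma \<mu>_submodular:
  assumes "F \<subseteq> X" "G \<subseteq> X"
  shows "\<mu> (F \<union> G) + \<mu> (F \<inter> G) \<le> \<mu> F + \<mu> G"
proof (rule field_le_epsilon)
  fix e :: real assume "e > 0"
  obtain V where V: "openin (top_of_set X) V" "F \<subseteq> V" "\<nu> V < \<mu> F + e / 2"
    using \<mu>_lessE[OF assms(1), of "\<mu> F + e / 2"] \<open>e > 0\<close> by auto
  obtain W where W: "openin (top_of_set X) W" "G \<subseteq> W" "\<nu> W < \<mu> G + e / 2"
    using \<mu>_lessE[OF assms(2), of "\<mu> G + e / 2"] \<open>e > 0\<close> by auto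
  have "\<mu> (F \<union> G) \<le> \<nu> (V \<union> W)" "\<mu> (F \<inter> G) \<le> \<nu> (V \<inter> W)"
    using V W by (auto intro!: \<mu>_le)
  then show "\<mu> (F \<union> G) + \<mu> (F \<inter> G) \<le> \<mu> F + \<mu> G + e"
    using modular[of V W] V(3) W(3) by linarith
qed

lemma \<mu>_preimage:
  assumes "F \<subseteq> X"
  shows "\<mu> {x \<in> X. T x \<in> F} = \<mu> F"
proof (rule antisym)
  show "\<mu> {x \<in> X. T x \<in> F} \<le> \<mu> F"
  proof (rule \<mu>_greatest[OF assms])
    fix V assume V: "openin (top_of_set X) V" "F \<subseteq> V"
    have "openin (top_of_set X) (X \<inter> T -` V)"
      using continuous_openin_preimage[OF cont_T _ V(1)] image_T by auto
    moreover have "X \<inter> T -` V = {x \<in> X. T x \<in> V}" by auto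
    ultimately have "\<mu> {x \<in> X. T x \<in> F} \<le> \<nu> {x \<in> X. T x \<in> V}"
      using V(2) by (intro \<mu>_le) auto
    then show "\<mu> {x \<in> X. T x \<in> F} \<le> \<nu> V" by (simp add: \<nu>_preimage)
  qed
  show "\<mu> F \<le> \<mu> {x \<in> X. T x \<in> F}"
  proof (rule \<mu>_greatest)
    fix W assume W: "openin (top_of_set X) W" "{x \<in> X. T x \<in> F} \<subseteq> W"
    \<comment> \<open>The largest subset of \<open>X\<close> whose preimage lies in
      \<open>W\<close>. It is open because \<open>T\<close> maps compact sets to compact
      sets.\<close>
    let ?V = "X - T ` (X - W)"
    have "closedin (top_of_set X) (X - W)" using W(1) by auto
    then have "compact (X - W)" using compact_X by (simp add: closedin_compact)
    then have "compact (T ` (X - W))"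
      by (intro compact_continuous_image continuous_on_subset[OF cont_T]) auto
    then have "closedin (top_of_set X) (T ` (X - W))"
      using image_T by (intro closed_subset compact_imp_closed) auto
    then have "openin (top_of_set X) ?V" by auto
    moreover have "F \<subseteq> ?V" using assms W(2) by auto
    ultimately have "\<mu> F \<le> \<nu> ?V" by (rule \<mu>_le)
    also have "\<dots> = \<nu> {x \<in> X. T x \<in> ?V}" by (simp only: \<nu>_preimage)
    also have "\<dots> \<le> \<nu> W" by (rule \<nu>_mono) auto
    finally show "\<mu> F \<le> \<nu> W" .
  qed auto
qed

lemma \<nu>_funpow: "\<nu> {x \<in> X. (T ^^ n) x \<in> A} = \<nu> A"
proof (induction n)
  case 0 then show ?case using restrict[of A] by (simp add: Int_def conj_commute)
next
  case (Suc n)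
  have "{x \<in> X. (T ^^ Suc n) x \<in> A} = {x \<in> X. T x \<in> {x \<in> X. (T ^^ n) x \<in> A}}"
    using image_T by (auto simp: funpow_swap1)
  then show ?case using Suc by (simp only: \<nu>_preimage)
qed

lemma \<nu>_finite_Union:
  "finite I \<Longrightarrow> (\<And>i. i \<in> I \<Longrightarrow> \<nu> (f i) \<le> 0) \<Longrightarrow> \<nu> (\<Union>i\<in>I. f i) = 0"
proof (induction I rule: finite_induct)
  case (insert i I)
  then show ?case
    using modular[of "f i" "\<Union>i\<in>I. f i"] nonneg[of "f i"] nonneg[of "f i \<inter> (\<Union>i\<in>I. f i)"]
      nonneg[of "f i \<union> (\<Union>i\<in>I. f i)"] by force
qed (simp add: empty)

text \<open>By minimality the preimages of \<open>V\<close> under the iterates cover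
  \<open>X\<close>, and by compactness finitely many suffice. All have the mass of \<open>V\<close>,
  so a null \<open>V\<close> would contradict \<open>total\<close>.\<close>

lemma \<nu>_open_pos:
  assumes "openin (top_of_set X) V" "V \<noteq> {}"
  shows "\<nu> V > 0"
proof (rule ccontr)
  assume "\<not> \<nu> V > 0"
  define P where "P n = {x \<in> X. (T ^^ n) x \<in> V}" for n
  have P_open: "openin (top_of_set X) (P n)" for n
  proof -
    have "openin (top_of_set X) (X \<inter> (T ^^ n) -` V)"
      using continuous_on_funpow[OF cont_T] funpow_mem[of T X] image_T assms(1)
      by (intro continuous_openin_preimage[of _ _ X]) auto
    moreover have "X \<inter> (T ^^ n) -` V = P n" by (auto simp: P_def)
    ultimately show ?thesis by simp
  qed
  have "X \<subseteq> (\<Union>n. P n)"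
  proof
    fix x assume x: "x \<in> X"
    have cl: "closure {(T ^^ n) x | n. True} = X"
      using minimal x by (auto simp: minimal_tds_def)
    obtain U where U: "open U" "V = X \<inter> U" using assms(1) by (auto simp: openin_open)
    then have "U \<inter> {(T ^^ n) x | n. True} \<noteq> {}"
      using assms(2) cl open_Int_closure_eq_empty[OF U(1)] by blast
    then show "x \<in> (\<Union>n. P n)"
      using x U funpow_mem[of T X x] image_T by (auto simp: P_def)
  qed
  moreover obtain U where U: "\<And>n. open (U n)" "\<And>n. P n = X \<inter> U n"
    using P_open unfolding openin_open by metis
  ultimately have "X \<subseteq> (\<Union>n. U n)" by blast
  then obtain I where "finite I" "X \<subseteq> (\<Union>n\<in>I. U n)"
    using compactE_image[OF compact_X, of UNIV U] U(1) by metis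
  then have I: "finite I" "X \<subseteq> (\<Union>n\<in>I. P n)" using U(2) by auto
  then have "\<nu> X \<le> \<nu> (\<Union>n\<in>I. P n)" by (intro \<nu>_mono)
  also have "\<dots> = 0"
    using I(1) \<open>\<not> \<nu> V > 0\<close> by (intro \<nu>_finite_Union) (auto simp: P_def \<nu>_funpow)
  finally show False using total by simp
qed

text \<open>Removing the closed set \<open>B\<close> from an open superset of the union leaves an
  open superset of \<open>F\<close>.\<close>

lemma \<mu>_disjoint_closed:
  assumes "F \<subseteq> X" "closedin (top_of_set X) B" "F \<inter> B = {}"
  shows "\<mu> F + \<nu> B \<le> \<mu> (F \<union> B)"
proof (rule \<mu>_greatest)
  show "F \<union> B \<subseteq> X" using assms closedin_imp_subset by blast
  fix V assume V: "openin (top_of_set X) V" "F \<union> B \<subseteq> V"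
  have "\<mu> F \<le> \<nu> (V - B)" using assms V by (intro \<mu>_le) (auto simp: openin_diff)
  moreover have "\<nu> ((V - B) \<union> B) = \<nu> (V - B) + \<nu> B" by (rule \<nu>_disjoint) auto
  moreover have "(V - B) \<union> B = V" using V by auto
  ultimately show "\<mu> F + \<nu> B \<le> \<nu> V" by simp
qed

end

section \<open>The gap pseudometric of a closed invariant relation\<close>

locale invariant_relation = minimal_mean +
  fixes N :: "('a \<times> 'a) set"
  assumes closed_N: "closed N" and N_subset: "N \<subseteq> X \<times> X"
    and N_invariant: "(x, y) \<in> N \<Longrightarrow> (T x, T y) \<in> N"
begin

lemma section_subset: "N `` A \<subseteq> X" using N_subset by auto

text \<open>The points whose section leaves \<open>V\<close> form the projection of a compact set.
  This is upper semicontinuity of the sections.\<close>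

lemma openin_sections:
  assumes "openin (top_of_set X) V"
  shows "openin (top_of_set X) {x \<in> X. N `` {x} \<subseteq> V}"
proof -
  have "closedin (top_of_set X) (X - V)" using assms by auto
  then have "compact (X - V)" using compact_X by (simp add: closedin_compact)
  then have "compact (N \<inter> X \<times> (X - V))"
    by (intro closed_Int_compact compact_Times compact_X closed_N)
  then have "compact (fst ` (N \<inter> X \<times> (X - V)))"
    by (intro compact_continuous_image continuous_intros)
  then have "closedin (top_of_set X) (fst ` (N \<inter> X \<times> (X - V)))"
    by (intro closed_subset compact_imp_closed) auto
  moreover have "{x \<in> X. N `` {x} \<subseteq> V} = X - fst ` (N \<inter> X \<times> (X - V))"
    using N_subset by force
  ultimately show ?thesis by auto
qed

lemma section_preimage: "x \<in> X \<Longrightarrow> N `` {x} \<subseteq> {y \<in> X. T y \<in> N `` {T x}}"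
  using N_subset N_invariant by auto

lemma \<mu>_section_const:
  assumes "x \<in> X" "y \<in> X" shows "\<mu> (N `` {x}) = \<mu> (N `` {y})"
proof -
  have "\<mu> (N `` {y}) \<le> \<mu> (N `` {x})" if "x \<in> X" "y \<in> X" for x y
  proof -
    \<comment> \<open>This superlevel set contains \<open>y\<close>. It is closed by upper
      semicontinuity and forward invariant by \<open>section_preimage\<close> and
      \<open>\<mu>_preimage\<close>, so minimality makes it all of \<open>X\<close>.\<close>
    let ?K = "{z \<in> X. \<mu> (N `` {y}) \<le> \<mu> (N `` {z})}"
    have "openin (top_of_set X) (X - ?K)"
    proof (subst openin_subopen, intro ballI)
      fix z assume "z \<in> X - ?K"
      then have z: "z \<in> X" "\<mu> (N `` {z}) < \<mu> (N `` {y})" by auto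
      obtain V where V: "openin (top_of_set X) V" "N `` {z} \<subseteq> V" "\<nu> V < \<mu> (N `` {y})"
        using \<mu>_lessE[OF section_subset z(2)] by blast
      have "{w \<in> X. N `` {w} \<subseteq> V} \<subseteq> X - ?K"
      proof
        fix w assume "w \<in> {w \<in> X. N `` {w} \<subseteq> V}"
        then show "w \<in> X - ?K" using \<mu>_le[OF V(1), of "N `` {w}"] V(3) by simp
      qed
      then show "\<exists>W. openin (top_of_set X) W \<and> z \<in> W \<and> W \<subseteq> X - ?K"
        using openin_sections[OF V(1)] z(1) V(2) by blast
    qed
    then have "closedin (top_of_set X) ?K" by (auto simp: closedin_def)
    then have "closed ?K" using closedin_closed_trans compact_X compact_imp_closed by blast
    moreover have "T ` ?K \<subseteq> ?K"
    proof clarsimp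
      fix z assume z: "z \<in> X" "\<mu> (N `` {y}) \<le> \<mu> (N `` {z})"
      have "\<mu> (N `` {z}) \<le> \<mu> {w \<in> X. T w \<in> N `` {T z}}"
        using section_preimage[OF z(1)] by (intro \<mu>_mono) auto
      then show "T z \<in> X \<and> \<mu> (N `` {y}) \<le> \<mu> (N `` {T z})"
        using z image_T \<mu>_preimage[OF section_subset, of "{T z}"] by auto
    qed
    ultimately have "?K = X"
      using that by (intro minimal_closed_invariant[OF minimal]) auto
    then show ?thesis using that by auto
  qed
  then show ?thesis using assms by (meson antisym)
qed

text \<open>For an additive measure this is the mass of the second section outside the first, half
  that of the symmetric difference when sections have equal mass. Writing it with unions lets
  submodularity do the work.\<close>

definition gap :: "'a \<Rightarrow> 'a \<Rightarrow> real" where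
  "gap x y = \<mu> (N `` {x} \<union> N `` {y}) - \<mu> (N `` {x})"

lemma gap_self: "gap x x = 0" by (simp add: gap_def)

lemma gap_commute: "x \<in> X \<Longrightarrow> y \<in> X \<Longrightarrow> gap x y = gap y x"
  using \<mu>_section_const[of x y] by (simp add: gap_def Un_commute)

text \<open>Submodularity is applied to the unions of neighbouring sections, whose intersection
  contains the section at \<open>y\<close>.\<close>

lemma gap_triangle:
  assumes "x \<in> X" "y \<in> X" "z \<in> X"
  shows "gap x z \<le> gap x y + gap y z"
proof -
  let ?F = "N `` {x}" let ?G = "N `` {y}" let ?H = "N `` {z}"
  have "\<mu> (?F \<union> ?H) \<le> \<mu> ((?F \<union> ?G) \<union> (?G \<union> ?H))"
    "\<mu> ?G \<le> \<mu> ((?F \<union> ?G) \<inter> (?G \<union> ?H))"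
    using section_subset by (auto intro!: \<mu>_mono)
  moreover have "\<mu> ((?F \<union> ?G) \<union> (?G \<union> ?H)) + \<mu> ((?F \<union> ?G) \<inter> (?G \<union> ?H))
      \<le> \<mu> (?F \<union> ?G) + \<mu> (?G \<union> ?H)"
    using section_subset by (intro \<mu>_submodular) auto
  ultimately show ?thesis by (simp add: gap_def)
qed

text \<open>The preimages \<open>F'\<close> and \<open>G'\<close> of the sections at the image
  points contain the old sections and have the same mass. By submodularity, enlarging one set at a
  time without changing its mass cannot increase the mass of a union.\<close>

lemma gap_T:
  assumes "x \<in> X" "y \<in> X"
  shows "gap (T x) (T y) \<le> gap x y"
proof -
  let ?F = "N `` {x}" let ?G = "N `` {y}"
  define F' where "F' = {w \<in> X. T w \<in> N `` {T x}}"
  define G' where "G' = {w \<in> X. T w \<in> N `` {T y}}"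
  have sub: "?F \<subseteq> F'" "?G \<subseteq> G'" "F' \<subseteq> X" "G' \<subseteq> X" "?F \<subseteq> X" "?G \<subseteq> X"
    using section_preimage assms section_subset by (auto simp: F'_def G'_def)
  have T: "T x \<in> X" "T y \<in> X" using assms image_T by auto
  have "\<mu> F' = \<mu> ?F" "\<mu> G' = \<mu> ?G"
    using \<mu>_preimage[OF section_subset, of "{T x}"] \<mu>_preimage[OF section_subset, of "{T y}"]
      \<mu>_section_const[OF T(1) assms(1)] \<mu>_section_const[OF T(2) assms(2)]
    by (simp_all add: F'_def G'_def)
  moreover have "\<mu> (F' \<union> G') + \<mu> ?F \<le> \<mu> F' + \<mu> (?F \<union> G')"
  proof -
    have "\<mu> (F' \<union> (?F \<union> G')) + \<mu> (F' \<inter> (?F \<union> G')) \<le> \<mu> F' + \<mu> (?F \<union> G')"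
      using sub by (intro \<mu>_submodular) auto
    moreover have "F' \<union> (?F \<union> G') = F' \<union> G'" using sub by auto
    moreover have "\<mu> ?F \<le> \<mu> (F' \<inter> (?F \<union> G'))" using sub by (intro \<mu>_mono) auto
    ultimately show ?thesis by simp
  qed
  moreover have "\<mu> (?F \<union> G') + \<mu> ?G \<le> \<mu> G' + \<mu> (?F \<union> ?G)"
  proof -
    have "\<mu> (G' \<union> (?F \<union> ?G)) + \<mu> (G' \<inter> (?F \<union> ?G)) \<le> \<mu> G' + \<mu> (?F \<union> ?G)"
      using sub by (intro \<mu>_submodular) auto
    moreover have "G' \<union> (?F \<union> ?G) = ?F \<union> G'" using sub by auto
    moreover have "\<mu> ?G \<le> \<mu> (G' \<inter> (?F \<union> ?G))" using sub by (intro \<mu>_mono) auto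
    ultimately show ?thesis by simp
  qed
  moreover have "\<mu> (F' \<union> G') = \<mu> (N `` {T x} \<union> N `` {T y})"
  proof -
    have "F' \<union> G' = {w \<in> X. T w \<in> N `` {T x} \<union> N `` {T y}}" by (auto simp: F'_def G'_def)
    then show ?thesis using \<mu>_preimage[of "N `` {T x} \<union> N `` {T y}"] section_subset by simp
  qed
  ultimately show ?thesis
    using \<mu>_section_const[of "T x" x] T assms by (simp add: gap_def)
qed

text \<open>A near-optimal open superset of the section at \<open>x\<close> also contains the
  sections at nearby points, and so bounds the mass of the union.\<close>

lemma gap_small:
  assumes "x \<in> X" "e > 0"
  shows "\<exists>d>0. \<forall>y\<in>X. dist y x < d \<longrightarrow> gap x y < e"
proof -
  obtain V where V: "openin (top_of_set X) V" "N `` {x} \<subseteq> V" "\<nu> V < \<mu> (N `` {x}) + e"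
    using \<mu>_lessE[OF section_subset, of "{x}" "\<mu> (N `` {x}) + e"] assms(2) by auto
  obtain d where d: "d > 0" "\<And>y. y \<in> X \<Longrightarrow> dist y x < d \<Longrightarrow> N `` {y} \<subseteq> V"
    using openin_sections[OF V(1)] V(2) assms(1) unfolding openin_euclidean_subtopology_iff by blast
  have "gap x y < e" if "y \<in> X" "dist y x < d" for y
    using \<mu>_le[OF V(1), of "N `` {x} \<union> N `` {y}"] V d that by (auto simp: gap_def)
  then show ?thesis using d(1) by blast
qed

lemma continuous_gap: "continuous_on (X \<times> X) (\<lambda>p. gap (fst p) (snd p))"
  unfolding continuous_on_iff
proof clarify
  fix x y and e :: real assume xy: "x \<in> X" "y \<in> X" and e: "e > 0"
  obtain d1 where d1: "d1 > 0" "\<And>x'. x' \<in> X \<Longrightarrow> dist x' x < d1 \<Longrightarrow> gap x x' < e / 2"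
    using gap_small[OF xy(1), of "e / 2"] e by auto
  obtain d2 where d2: "d2 > 0" "\<And>y'. y' \<in> X \<Longrightarrow> dist y' y < d2 \<Longrightarrow> gap y y' < e / 2"
    using gap_small[OF xy(2), of "e / 2"] e by auto
  show "\<exists>d>0. \<forall>p\<in>X \<times> X. dist p (x, y) < d \<longrightarrow>
      dist (gap (fst p) (snd p)) (gap (fst (x, y)) (snd (x, y))) < e"
  proof (intro exI[of _ "min d1 d2"] conjI ballI impI)
    fix p assume p: "p \<in> X \<times> X" "dist p (x, y) < min d1 d2"
    then obtain x' y' where x'y': "p = (x', y')" "x' \<in> X" "y' \<in> X" by auto
    have "dist x' x < d1" "dist y' y < d2"
      using p(2) dist_fst_le[of p "(x, y)"] dist_snd_le[of p "(x, y)"] by (auto simp: x'y')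
    then have "gap x x' < e / 2" "gap y y' < e / 2" using d1 d2 x'y' by auto
    moreover have "gap x' y' \<le> gap x' x + gap x y + gap y y'" "gap x y \<le> gap x x' + gap x' y' + gap y' y"
      using gap_triangle[of x' x y'] gap_triangle[of x y y'] gap_triangle[of x x' y]
        gap_triangle[of x' y' y] xy x'y' by auto
    ultimately show "dist (gap (fst p) (snd p)) (gap (fst (x, y)) (snd (x, y))) < e"
      using gap_commute[of x x'] gap_commute[of y y'] xy x'y' by (auto simp: dist_real_def)
  qed (use d1 d2 in auto)
qed

text \<open>If \<open>V\<close> missed the section at \<open>y\<close>, a small ball inside
  \<open>V\<close> would add positive mass to that section, while a vanishing gap leaves no room for
  it.\<close>

lemma gap_zero_meets:
  assumes "x \<in> X" "y \<in> X" "gap x y = 0"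
    and "openin (top_of_set X) V" "V \<noteq> {}" "V \<subseteq> N `` {x}"
  shows "V \<inter> N `` {y} \<noteq> {}"
proof
  assume dis: "V \<inter> N `` {y} = {}"
  obtain b where b: "b \<in> V" using assms(5) by auto
  then obtain r where r: "r > 0" "\<And>z. z \<in> X \<Longrightarrow> dist z b < r \<Longrightarrow> z \<in> V" "b \<in> X"
    using assms(4) unfolding openin_euclidean_subtopology_iff by blast
  \<comment> \<open>The closed ball suits \<open>\<mu>_disjoint_closed\<close>; its positive mass
    comes from the open ball of the same radius.\<close>
  let ?B = "X \<inter> cball b (r / 2)"
  have "?B \<subseteq> V" using r by (auto simp: dist_commute intro!: r(2))
  then have "\<mu> (N `` {y}) + \<nu> ?B \<le> \<mu> (N `` {y} \<union> ?B)"
    using dis by (intro \<mu>_disjoint_closed section_subset closedin_closed_Int closed_cball) auto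
  also have "\<dots> \<le> \<mu> (N `` {x} \<union> N `` {y})"
    using \<open>?B \<subseteq> V\<close> assms(6) section_subset by (intro \<mu>_mono) auto
  also have "\<dots> = \<mu> (N `` {y})"
    using assms(1-3) \<mu>_section_const[of x y] by (simp add: gap_def)
  finally have "\<nu> ?B \<le> 0" by simp
  moreover have "\<nu> (X \<inter> ball b (r / 2)) > 0"
    using r by (intro \<nu>_open_pos openin_open_Int) auto
  moreover have "\<nu> (X \<inter> ball b (r / 2)) \<le> \<nu> ?B" by (intro \<nu>_mono) auto
  ultimately show False by simp
qed

end

subsection \<open>Equicontinuous factors\<close>


text \<open>The factor is the quotient by the relation \<open>\<rho> x y = 0\<close>, realised in
  the type over which \<open>max_equicontinuous_factor\<close> quantifies.\<close>

lemma pseudometric_factor: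
  fixes X :: "'a::metric_space set" and \<rho> :: "'a \<Rightarrow> 'a \<Rightarrow> real"
  assumes min: "minimal_tds X T"
    and self: "\<And>x. x \<in> X \<Longrightarrow> \<rho> x x = 0"
    and commute: "\<And>x y. x \<in> X \<Longrightarrow> y \<in> X \<Longrightarrow> \<rho> x y = \<rho> y x"
    and triangle: "\<And>x y z. x \<in> X \<Longrightarrow> y \<in> X \<Longrightarrow> z \<in> X \<Longrightarrow> \<rho> x z \<le> \<rho> x y + \<rho> y z"
    and nonexpansive: "\<And>x y. x \<in> X \<Longrightarrow> y \<in> X \<Longrightarrow> \<rho> (T x) (T y) \<le> \<rho> x y"
    and cont: "continuous_on (X \<times> X) (\<lambda>p. \<rho> (fst p) (snd p))"
  obtains Z :: "(nat \<Rightarrow> real) set" and R \<psi>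
  where "factor_map X T Z R \<psi>" "equicontinuous_tds Z R"
    "\<And>x y. x \<in> X \<Longrightarrow> y \<in> X \<Longrightarrow> \<psi> x = \<psi> y \<Longrightarrow> \<rho> x y = 0"
proof -
  have tds: "tds X T" using min by (simp add: minimal_tds_def)
  then have comp: "compact X" and T: "continuous_on X T" "T ` X = X" and ne: "X \<noteq> {}"
    by (auto simp: tds_def)
  obtain x0 where x0: "x0 \<in> X" using ne by auto
  define q where "q n = (T ^^ n) x0" for n
  have qX: "q n \<in> X" for n using funpow_mem[of T X x0] T x0 by (auto simp: q_def)
  have dense: "closure (range q) = X"
    using min x0 by (auto simp: minimal_tds_def q_def full_SetCompr_eq)
  \<comment> \<open>The distances to a dense orbit embed the quotient of \<open>X\<close> by \<open>\<rho>\<close> into \<open>nat \<Rightarrow> real\<close>.\<close>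
  define \<psi> where "\<psi> x = (\<lambda>n. \<rho> x (q n))" for x
  have nonneg: "0 \<le> \<rho> x y" if "x \<in> X" "y \<in> X" for x y
    using triangle[of x y x] self[of x] commute[of x y] that by auto
  have cont_comp: "continuous_on A (\<lambda>a. \<rho> (f a) (g a))"
    if "continuous_on A f" "continuous_on A g" "f ` A \<subseteq> X" "g ` A \<subseteq> X" for A :: "'c::topological_space set" and f g
    using continuous_on_compose2[OF cont continuous_on_Pair[OF that(1,2)]] that(3,4) by auto
  have \<psi>_eq: "\<psi> x = \<psi> y \<longleftrightarrow> \<rho> x y = 0" if xy: "x \<in> X" "y \<in> X" for x y
  proof
    assume eq: "\<psi> x = \<psi> y"
    \<comment> \<open>The two distance functions agree on the dense orbit, hence on all of
      \<open>X\<close>; evaluation at \<open>y\<close> gives zero.\<close>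
    have "closed {z \<in> X. \<rho> x z = \<rho> y z}"
      using xy compact_imp_closed[OF comp]
      by (intro continuous_closed_preimage_constant[where f = "\<lambda>z. \<rho> x z - \<rho> y z" and a = 0, simplified]
          continuous_intros cont_comp) auto
    moreover have "range q \<subseteq> {z \<in> X. \<rho> x z = \<rho> y z}"
      using qX fun_cong[OF eq] by (auto simp: \<psi>_def)
    ultimately have "X \<subseteq> {z \<in> X. \<rho> x z = \<rho> y z}"
      using closure_minimal dense by metis
    then show "\<rho> x y = 0" using xy self by auto
  next
    assume zero: "\<rho> x y = 0"
    have "\<rho> x z = \<rho> y z" if "z \<in> X" for z
      using triangle[of x y z] triangle[of y x z] commute[of x y] zero xy that by auto
    then show "\<psi> x = \<psi> y" using qX by (auto simp: \<psi>_def)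
  qed
  have cont_\<psi>: "continuous_on X \<psi>"
    unfolding \<psi>_def
    using qX by (intro continuous_on_coordinatewise_then_product cont_comp continuous_intros) auto
  define Z where "Z = \<psi> ` X"
  \<comment> \<open>The choice of preimage is immaterial, since \<open>\<rho>\<close> does not grow
    under \<open>T\<close>.\<close>
  define R where "R z = \<psi> (T (inv_into X \<psi> z))" for z
  have TX: "T x \<in> X" if "x \<in> X" for x using T that by auto
  have R_\<psi>: "R (\<psi> x) = \<psi> (T x)" if "x \<in> X" for x
  proof -
    let ?y = "inv_into X \<psi> (\<psi> x)"
    have y: "?y \<in> X" "\<psi> ?y = \<psi> x"
      using that by (auto intro: inv_into_into f_inv_into_f)
    then have "\<rho> ?y x = 0" using \<psi>_eq that by auto
    then have "\<rho> (T ?y) (T x) = 0"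
      using nonexpansive[OF y(1) that] nonneg[OF TX[OF y(1)] TX[OF that]] by auto
    then show ?thesis using \<psi>_eq TX y that by (auto simp: R_def)
  qed
  have R_funpow: "(R ^^ n) (\<psi> x) = \<psi> ((T ^^ n) x)" "(T ^^ n) x \<in> X" if "x \<in> X" for n x
    using that by (induction n) (auto simp: R_\<psi> TX)
  have \<rho>_funpow: "\<rho> ((T ^^ n) x) ((T ^^ n) y) \<le> \<rho> x y" if "x \<in> X" "y \<in> X" for n x y
    using that R_funpow(2) by (induction n) (auto intro: order_trans[OF nonexpansive])
  have equi: "\<exists>d>0. \<forall>y1\<in>Z. \<forall>y2\<in>Z. dist y1 y2 < d \<longrightarrow> (\<forall>n. dist ((R ^^ n) y1) ((R ^^ n) y2) < e)"
    if "e > 0" for e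
  proof (rule ccontr)
    assume "\<not> ?thesis"
    then have "\<forall>d>0. \<exists>x\<in>X. \<exists>y\<in>X. \<exists>n. dist (\<psi> x) (\<psi> y) < d \<and>
        e \<le> dist (\<psi> ((T ^^ n) x)) (\<psi> ((T ^^ n) y))"
      unfolding Z_def using R_funpow(1) by (simp add: not_less) (meson not_le)
    then have "\<forall>i. \<exists>x\<in>X. \<exists>y\<in>X. \<exists>n. dist (\<psi> x) (\<psi> y) < inverse (real (Suc i)) \<and>
        e \<le> dist (\<psi> ((T ^^ n) x)) (\<psi> ((T ^^ n) y))"
      using inverse_positive_iff_positive of_nat_0_less_iff zero_less_Suc by blast
    then obtain x y n where xyn: "\<And>i. x i \<in> X" "\<And>i. y i \<in> X"
        "\<And>i. dist (\<psi> (x i)) (\<psi> (y i)) < inverse (real (Suc i))"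
        "\<And>i. e \<le> dist (\<psi> ((T ^^ n i) (x i))) (\<psi> ((T ^^ n i) (y i)))"
      by metis
    \<comment> \<open>The metric of \<open>Z\<close> is not \<open>\<rho>\<close>, so compactness is
      needed. Counterexamples accumulate at a pair with \<open>\<rho> a b = 0\<close>; then
      \<open>\<rho> c d = 0\<close> too, although the images of \<open>c\<close> and
      \<open>d\<close> stay \<open>e\<close> apart.\<close>
    define w where "w i = ((x i, y i), ((T ^^ n i) (x i), (T ^^ n i) (y i)))" for i
    have "compact ((X \<times> X) \<times> (X \<times> X))" by (intro compact_Times comp)
    then obtain l r where l: "l \<in> (X \<times> X) \<times> (X \<times> X)" "strict_mono r" "(w \<circ> r) \<longlonglongrightarrow> l"
      unfolding compact_def using xyn(1,2) R_funpow(2) by (metis (no_types, lifting) SigmaI w_def)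
    obtain a b c d where abcd: "l = ((a, b), (c, d))" by (metis surj_pair)
    have in_X: "a \<in> X" "b \<in> X" "c \<in> X" "d \<in> X" using l(1) abcd by auto
    have lims: "(\<lambda>i. x (r i)) \<longlonglongrightarrow> a" "(\<lambda>i. y (r i)) \<longlonglongrightarrow> b"
      "(\<lambda>i. (T ^^ n (r i)) (x (r i))) \<longlonglongrightarrow> c" "(\<lambda>i. (T ^^ n (r i)) (y (r i))) \<longlonglongrightarrow> d"
      using tendsto_fst[OF tendsto_fst[OF l(3)]] tendsto_snd[OF tendsto_fst[OF l(3)]]
        tendsto_fst[OF tendsto_snd[OF l(3)]] tendsto_snd[OF tendsto_snd[OF l(3)]]
      by (auto simp: w_def abcd o_def)
    have \<psi>_lim: "(\<lambda>i. \<psi> (u i)) \<longlonglongrightarrow> \<psi> v" if "u \<longlonglongrightarrow> v" "v \<in> X" "\<And>i. u i \<in> X" for u v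
      using continuous_on_tendsto_compose[OF cont_\<psi> that(1,2)] that(3) by auto
    have \<rho>_lim: "(\<lambda>i. \<rho> (u i) (u' i)) \<longlonglongrightarrow> \<rho> v v'"
      if "u \<longlonglongrightarrow> v" "v \<in> X" "\<And>i. u i \<in> X" "u' \<longlonglongrightarrow> v'" "v' \<in> X" "\<And>i. u' i \<in> X" for u v u' v'
      using continuous_on_tendsto_compose[OF cont tendsto_Pair[OF that(1,4)]] that by auto
    have "(\<lambda>i. dist (\<psi> (x (r i))) (\<psi> (y (r i)))) \<longlonglongrightarrow> dist (\<psi> a) (\<psi> b)"
      by (intro tendsto_dist \<psi>_lim lims in_X xyn)
    moreover have "(\<lambda>i. dist (\<psi> (x (r i))) (\<psi> (y (r i)))) \<longlonglongrightarrow> 0"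
    proof (rule tendsto_sandwich[OF _ _ tendsto_const])
      show "(\<lambda>i. inverse (real (Suc (r i)))) \<longlonglongrightarrow> 0"
        using LIMSEQ_subseq_LIMSEQ[OF LIMSEQ_inverse_real_of_nat l(2)] by (simp add: o_def)
      show "\<forall>\<^sub>F i in sequentially. dist (\<psi> (x (r i))) (\<psi> (y (r i))) \<le> inverse (real (Suc (r i)))"
        using xyn(3) by (intro always_eventually) (auto intro: less_imp_le)
    qed auto
    ultimately have "\<psi> a = \<psi> b" using LIMSEQ_unique by fastforce
    then have "\<rho> a b = 0" using \<psi>_eq in_X by auto
    moreover have "\<rho> c d \<le> \<rho> a b"
      by (rule LIMSEQ_le[OF \<rho>_lim[OF lims(3) in_X(3) _ lims(4) in_X(4)]
            \<rho>_lim[OF lims(1) in_X(1) _ lims(2) in_X(2)]])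
        (use xyn R_funpow(2) \<rho>_funpow in auto)
    ultimately have "\<psi> c = \<psi> d" using \<psi>_eq nonneg in_X by (metis antisym)
    moreover have "e \<le> dist (\<psi> c) (\<psi> d)"
      by (rule LIMSEQ_le_const[OF tendsto_dist[OF \<psi>_lim[OF lims(3) in_X(3)] \<psi>_lim[OF lims(4) in_X(4)]]])
        (use xyn R_funpow(2) in auto)
    ultimately show False using that by simp
  qed
  have "continuous_on Z R"
    unfolding continuous_on_iff
  proof (intro ballI allI impI)
    fix z and e :: real assume "z \<in> Z" "e > 0"
    from equi[OF this(2)] obtain d where d: "d > 0"
      "\<forall>y1\<in>Z. \<forall>y2\<in>Z. dist y1 y2 < d \<longrightarrow> (\<forall>n. dist ((R ^^ n) y1) ((R ^^ n) y2) < e)" by auto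
    have "dist (R z') (R z) < e" if "z' \<in> Z" "dist z' z < d" for z'
    proof -
      have "\<forall>n. dist ((R ^^ n) z') ((R ^^ n) z) < e" using d(2) that \<open>z \<in> Z\<close> by blast
      from spec[OF this, of 1] show ?thesis by simp
    qed
    then show "\<exists>d>0. \<forall>z'\<in>Z. dist z' z < d \<longrightarrow> dist (R z') (R z) < e"
      using d(1) by blast
  qed
  moreover have "R ` Z = Z"
  proof -
    have "R ` Z = \<psi> ` (T ` X)" using R_\<psi> by (force simp: Z_def)
    then show ?thesis using T by (simp add: Z_def)
  qed
  moreover have "compact Z" unfolding Z_def by (intro compact_continuous_image cont_\<psi> comp)
  ultimately have "tds Z R" using ne by (auto simp: tds_def Z_def)
  then have "factor_map X T Z R \<psi>" "equicontinuous_tds Z R"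
    using tds cont_\<psi> R_\<psi> equi by (auto simp: factor_map_def equicontinuous_tds_def Z_def)
  then show thesis using that \<psi>_eq by blast
qed

text \<open>Two points of a backward orbit of \<open>(u, v)\<close> that are close to each other show, after applying
an iterate of \<open>S\<close>, that \<open>(u, v)\<close> is recurrent.\<close>
lemma equicontinuous_distal:
  assumes equi: "equicontinuous_tds Y S" and uv: "u \<in> Y" "v \<in> Y"
    and close: "\<And>e. e > 0 \<Longrightarrow> \<exists>n. dist ((S ^^ n) u) ((S ^^ n) v) < e"
  shows "u = v"
proof (rule ccontr)
  assume "u \<noteq> v"
  define e where "e = dist u v / 3"
  have e: "e > 0" using \<open>u \<noteq> v\<close> by (simp add: e_def)
  obtain d where d: "d > 0"
    "\<And>y1 y2 n. y1 \<in> Y \<Longrightarrow> y2 \<in> Y \<Longrightarrow> dist y1 y2 < d \<Longrightarrow> dist ((S ^^ n) y1) ((S ^^ n) y2) < e"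
    using equi e unfolding equicontinuous_tds_def by metis
  have S: "S ` Y = Y" "compact Y" using equi by (auto simp: equicontinuous_tds_def tds_def)
  have SY: "(S ^^ n) y \<in> Y" if "y \<in> Y" for n y using funpow_mem[of S Y] S that by auto
  \<comment> \<open>\<open>S\<close> is not assumed injective; a right inverse selects one backward
    orbit for each point.\<close>
  define s where "s = inv_into Y S"
  have s: "s y \<in> Y" "S (s y) = y" if "y \<in> Y" for y
    using that S by (auto simp: s_def intro: inv_into_into f_inv_into_f)
  have sY: "(s ^^ n) y \<in> Y" if "y \<in> Y" for n y using funpow_mem[of s Y] s that by auto
  have cancel: "(S ^^ n) ((s ^^ n) y) = y" if "y \<in> Y" for n y
    using that 
  proof (induction n)
    case (Suc n)
    have "(S ^^ Suc n) ((s ^^ Suc n) y) = (S ^^ n) (S (s ((s ^^ n) y)))"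
      by (simp add: funpow_swap1)
    then show ?case using Suc s(2)[OF sY[of y n]] by simp
  qed auto
  obtain n where n: "dist ((S ^^ n) u) ((S ^^ n) v) < d" using close d(1) by auto
  have late: "dist ((S ^^ p) u) ((S ^^ p) v) < e" if "n \<le> p" for p
    using d(2)[OF SY[OF uv(1)] SY[OF uv(2)] n, of "p - n"] that
    by (metis comp_apply funpow_add le_add_diff_inverse2)
  define w where "w k = ((s ^^ k) u, (s ^^ k) v)" for k
  have "compact (Y \<times> Y)" by (intro compact_Times S)
  then obtain l r where l: "strict_mono r" "(w \<circ> r) \<longlonglongrightarrow> l"
    unfolding compact_def using sY[OF uv(1)] sY[OF uv(2)] by (metis (no_types, lifting) SigmaI w_def)
  then have "Cauchy (w \<circ> r)" by (intro LIMSEQ_imp_Cauchy)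
  then obtain M where M: "\<And>i j. i \<ge> M \<Longrightarrow> j \<ge> M \<Longrightarrow> dist (w (r i)) (w (r j)) < d"
    unfolding Cauchy_def using d(1) by (simp add: o_def) blast
  \<comment> \<open>The later index is so large that \<open>p\<close> is at least \<open>n\<close>,
    which \<open>late\<close> requires.\<close>
  define p where "p = r (r M + n + M) - r M"
  have big: "r M + n + M \<le> r (r M + n + M)" using l(1) by (rule seq_suble)
  \<comment> \<open>The larger iterate of \<open>S\<close> sends the two close points of the
    backward orbit to \<open>(S ^^ p) y\<close> and to \<open>y\<close>.\<close>
  have recur: "dist ((S ^^ p) y) y < e" if "y \<in> Y" "dist ((s ^^ r M) y) ((s ^^ r (r M + n + M)) y) < d" for y
  proof -
    have "(S ^^ r (r M + n + M)) ((s ^^ r M) y) = (S ^^ p) y"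
      using cancel[OF that(1), of "r M"] big
      by (metis add_leD1 comp_apply funpow_add le_add_diff_inverse2 p_def)
    then show ?thesis
      using d(2)[OF sY sY that(2), of "r (r M + n + M)"] that(1) cancel by auto
  qed
  have "dist (w (r M)) (w (r (r M + n + M))) < d" by (intro M) auto
  then have "dist ((S ^^ p) u) u < e" "dist ((S ^^ p) v) v < e"
    using dist_fst_le[of "w (r M)" "w (r (r M + n + M))"] dist_snd_le[of "w (r M)" "w (r (r M + n + M))"]
    by (auto intro!: recur uv simp: w_def)
  moreover have "dist ((S ^^ p) u) ((S ^^ p) v) < e" using big by (intro late) (auto simp: p_def)
  ultimately show False
    using dist_triangle[of u v "(S ^^ p) u"] dist_triangle[of "(S ^^ p) u" v "(S ^^ p) v"]
    by (simp add: e_def dist_commute)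
qed

subsection \<open>Fibres of the maximal equicontinuous factor\<close>


lemma minimal_mean_exists:
  assumes "minimal_tds X T"
  obtains \<nu> where "minimal_mean X T \<nu>"
proof -
  obtain x where x: "x \<in> X" "T ` X \<subseteq> X" using assms by (auto simp: minimal_tds_def tds_def)
  obtain \<nu> where \<nu>: "\<And>A. 0 \<le> \<nu> A" "\<nu> {} = 0" "\<And>A B. \<nu> (A \<union> B) + \<nu> (A \<inter> B) = \<nu> A + \<nu> B"
    "\<And>A. \<nu> (T -` A) = \<nu> A" "\<And>A. (\<And>n. (T ^^ n) x \<in> A) \<Longrightarrow> \<nu> A = (1::real)"
    using invariant_mean[of T x] by blast
  \<comment> \<open>The orbit stays in \<open>X\<close>, so \<open>X\<close> and
    \<open>A \<union> X\<close> both have mass one, and the modular law gives the equality.\<close>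
  have "\<nu> (A \<inter> X) = \<nu> A" for A
    using \<nu>(3)[of A X] \<nu>(5)[of "A \<union> X"] \<nu>(5)[of X] funpow_mem[OF x(2,1)] by simp
  then have "minimal_mean X T \<nu>"
    using assms \<nu> funpow_mem[OF x(2,1)] by unfold_locales auto
  then show thesis by (rule that)
qed

text \<open>The universal property of \<open>Y\<close> enters here: the quotient by
  \<open>gap\<close> is an equicontinuous factor, so it factors through \<open>\<pi>\<close> and
  \<open>gap\<close> vanishes on fibres.\<close>

lemma section_meets:
  assumes min: "minimal_tds X T" and max: "max_equicontinuous_factor X T Y S \<pi>"
    and N: "closed N" "N \<subseteq> X \<times> X" "\<And>x y. (x, y) \<in> N \<Longrightarrow> (T x, T y) \<in> N"
    and xy: "x \<in> X" "y \<in> X" "\<pi> x = \<pi> y"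
    and V: "openin (top_of_set X) V" "V \<noteq> {}" "V \<subseteq> N `` {x}"
  shows "V \<inter> N `` {y} \<noteq> {}"
proof -
  obtain \<nu> where "minimal_mean X T \<nu>" using minimal_mean_exists[OF min] .
  then interpret minimal_mean X T \<nu> .
  interpret invariant_relation X T \<nu> N using N by unfold_locales
  obtain Z :: "(nat \<Rightarrow> real) set" and R \<psi> where \<psi>: "factor_map X T Z R \<psi>" "equicontinuous_tds Z R"
    "\<And>x y. x \<in> X \<Longrightarrow> y \<in> X \<Longrightarrow> \<psi> x = \<psi> y \<Longrightarrow> gap x y = 0"
    using pseudometric_factor[OF min, of gap] gap_self gap_commute gap_triangle gap_T continuous_gap
    by blast
  then obtain \<phi> where "\<forall>x\<in>X. \<psi> x = \<phi> (\<pi> x)"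
    using max unfolding max_equicontinuous_factor_def by blast
  then have "gap x y = 0" using \<psi>(3) xy by auto
  then show ?thesis using gap_zero_meets xy V by blast
qed

lemma factor_map_funpow:
  assumes "factor_map X T Y S \<pi>" "x \<in> X"
  shows "\<pi> ((T ^^ n) x) = (S ^^ n) (\<pi> x)"
proof (induction n)
  case (Suc n)
  have "(T ^^ n) x \<in> X" using assms by (intro funpow_mem) (auto simp: factor_map_def tds_def)
  with Suc show ?case using assms by (auto simp: factor_map_def)
qed auto

text \<open>The starting time \<open>k\<close> is a parameter because regional proximality counts
  from time one and proximality from time zero.\<close>

lemma closed_separated_pairs:
  fixes X :: "'a::metric_space set"
  assumes "tds X T"
  shows "closed {p \<in> X \<times> X. \<forall>n\<ge>k. c \<le> dist ((T ^^ n) (fst p)) ((T ^^ n) (snd p))}"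
proof -
  have "compact X" and T: "continuous_on X T" "T ` X \<subseteq> X"
    using assms by (auto simp: tds_def)
  then have X: "closed (X \<times> X)" by (intro closed_Times compact_imp_closed)
  have cont: "continuous_on (X \<times> X) (\<lambda>p. dist ((T ^^ n) (fst p)) ((T ^^ n) (snd p)))" for n
    by (intro continuous_on_dist continuous_on_compose2[OF continuous_on_funpow[OF T]]
        continuous_intros) auto
  have "closed {p \<in> X \<times> X. c \<le> dist ((T ^^ n) (fst p)) ((T ^^ n) (snd p))}" for n
    by (rule continuous_on_closed_Collect_le[OF continuous_on_const cont X])
  then have "closed ((X \<times> X) \<inter>
      (\<Inter>n\<in>{k..}. {p \<in> X \<times> X. c \<le> dist ((T ^^ n) (fst p)) ((T ^^ n) (snd p))}))"
    using X by blast
  moreover have "(X \<times> X) \<inter>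
      (\<Inter>n\<in>{k..}. {p \<in> X \<times> X. c \<le> dist ((T ^^ n) (fst p)) ((T ^^ n) (snd p))}) =
      {p \<in> X \<times> X. \<forall>n\<ge>k. c \<le> dist ((T ^^ n) (fst p)) ((T ^^ n) (snd p))}" by auto
  ultimately show ?thesis by simp
qed

lemma fiber_regionally_proximal:
  assumes min: "minimal_tds X T" and max: "max_equicontinuous_factor X T Y S \<pi>"
    and xy: "x \<in> X" "y \<in> X" "\<pi> x = \<pi> y"
  shows "regionally_proximal X T x y"
  unfolding regionally_proximal_def
proof (intro allI impI)
  fix e :: real and U1 U2
  assume e: "e > 0" and U: "openin (top_of_set X) U1 \<and> x \<in> U1 \<and> openin (top_of_set X) U2 \<and> y \<in> U2"
  show "\<exists>x1'\<in>U1. \<exists>x2'\<in>U2. \<exists>n\<ge>1. dist ((T ^^ n) x1') ((T ^^ n) x2') < e"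
  proof (rule ccontr)
    assume far: "\<not> ?thesis"
    define N where "N = {p \<in> X \<times> X. \<forall>n\<ge>1. e \<le> dist ((T ^^ n) (fst p)) ((T ^^ n) (snd p))}"
    have tds: "tds X T" using min by (simp add: minimal_tds_def)
    then have T: "continuous_on X T" "T ` X = X" by (auto simp: tds_def)
    \<comment> \<open>All of \<open>U2\<close> lies in the section of \<open>N\<close> at
      \<open>x\<close>. The ball is taken around \<open>T y\<close>, not \<open>y\<close>, because
      \<open>N\<close> constrains only times from one on; it makes \<open>V\<close> miss the section
      at \<open>y\<close>.\<close>
    define V where "V = U2 \<inter> (X \<inter> T -` ball (T y) e)"
    have "openin (top_of_set X) V"
      using U unfolding V_def by (intro openin_Int continuous_openin_preimage_gen T) auto
    moreover have "y \<in> V" using U xy e by (auto simp: V_def)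
    moreover have "V \<subseteq> N `` {x}"
      using far U xy by (auto simp: V_def N_def not_less)
    moreover have "(T a, T b) \<in> N" if "(a, b) \<in> N" for a b
    proof -
      have "e \<le> dist ((T ^^ n) (T a)) ((T ^^ n) (T b))" if "n \<ge> 1" for n
        using \<open>(a, b) \<in> N\<close> by (auto simp: N_def dest!: spec[of _ "Suc n"] simp: funpow_swap1)
      then show ?thesis using that T by (auto simp: N_def)
    qed
    moreover have "closed N" unfolding N_def by (rule closed_separated_pairs[OF tds])
    ultimately have "V \<inter> N `` {y} \<noteq> {}"
      using xy by (intro section_meets[OF min max, of N x y V]) (auto simp: N_def)
    then obtain b where "b \<in> V" "(y, b) \<in> N" by auto
    then have "dist (T y) (T b) < e" "e \<le> dist (T y) (T b)"
      by (auto simp: V_def N_def dest: spec[of _ 1])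
    then show False by simp
  qed
qed

text \<open>Regional proximality passes to \<open>\<pi> x\<close> and \<open>\<pi> y\<close>, where
  equicontinuity turns it into proximality; distality then gives equality.\<close>

lemma regionally_proximal_fiber:
  assumes fac: "factor_map X T Y S \<pi>" and equi: "equicontinuous_tds Y S"
    and xy: "x \<in> X" "y \<in> X" and rp: "regionally_proximal X T x y"
  shows "\<pi> x = \<pi> y"
proof (rule equicontinuous_distal[OF equi])
  have fac': "compact X" "continuous_on X \<pi>" "\<pi> ` X = Y" "T ` X = X"
    using fac by (auto simp: factor_map_def tds_def)
  then show "\<pi> x \<in> Y" "\<pi> y \<in> Y" using xy by auto
  fix e :: real assume "e > 0"
  then have e3: "e / 3 > 0" by simp
  from equi obtain d where d: "d > 0" "\<And>y1 y2 n. y1 \<in> Y \<Longrightarrow> y2 \<in> Y \<Longrightarrow> dist y1 y2 < d \<Longrightarrow>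
      dist ((S ^^ n) y1) ((S ^^ n) y2) < e / 3"
    using e3 unfolding equicontinuous_tds_def by metis
  have unif: "uniformly_continuous_on X \<pi>"
    by (rule compact_uniformly_continuous[OF fac'(2,1)])
  \<comment> \<open>\<open>\<eta>\<close> controls \<open>\<pi>\<close> after \<open>n\<close>
    steps, while \<open>\<theta>\<close> controls it at the start, where equicontinuity takes
    over.\<close>
  obtain \<eta> where \<eta>: "\<eta> > 0" "\<And>a b. a \<in> X \<Longrightarrow> b \<in> X \<Longrightarrow> dist b a < \<eta> \<Longrightarrow> dist (\<pi> b) (\<pi> a) < e / 3"
    using unif e3 unfolding uniformly_continuous_on_def by metis
  obtain \<theta> where \<theta>: "\<theta> > 0" "\<And>a b. a \<in> X \<Longrightarrow> b \<in> X \<Longrightarrow> dist b a < \<theta> \<Longrightarrow> dist (\<pi> b) (\<pi> a) < d"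
    using unif d(1) unfolding uniformly_continuous_on_def by metis
  obtain x' y' n where x'y': "x' \<in> X \<inter> ball x \<theta>" "y' \<in> X \<inter> ball y \<theta>"
    and n: "dist ((T ^^ n) x') ((T ^^ n) y') < \<eta>"
    using rp \<eta>(1) \<theta>(1) xy unfolding regionally_proximal_def
    by (metis IntI centre_in_ball open_ball openin_open_Int)
  have TX: "(T ^^ n) a \<in> X" if "a \<in> X" for a using funpow_mem[of T X] fac' that by auto
  have near: "dist ((S ^^ n) (\<pi> a)) ((S ^^ n) (\<pi> a')) < e / 3"
    if "a \<in> X" "a' \<in> X \<inter> ball a \<theta>" for a a'
    using that fac' by (intro d(2) \<theta>(2)) (auto simp: dist_commute)
  have "dist ((S ^^ n) (\<pi> x')) ((S ^^ n) (\<pi> y')) < e / 3"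
    using \<eta>(2)[OF TX TX n] x'y' by (simp add: factor_map_funpow[OF fac])
  then have "dist ((S ^^ n) (\<pi> x)) ((S ^^ n) (\<pi> y)) < e"
    using near[OF xy(1) x'y'(1)] near[OF xy(2) x'y'(2)]
      dist_triangle[of "(S ^^ n) (\<pi> x)" "(S ^^ n) (\<pi> y)" "(S ^^ n) (\<pi> x')"]
      dist_triangle[of "(S ^^ n) (\<pi> x')" "(S ^^ n) (\<pi> y)" "(S ^^ n) (\<pi> y')"]
    by (simp add: dist_commute)
  then show "\<exists>n. dist ((S ^^ n) (\<pi> x)) ((S ^^ n) (\<pi> y)) < e" by auto
qed

text \<open>Pairs in a common fibre that stay \<open>c\<close> apart form a compact forward
  invariant set. Its first projection is therefore all of \<open>X\<close>, with the same
  \<open>c\<close> at every point.\<close>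

lemma separated_partner:
  fixes X :: "'a::metric_space set" and \<pi> :: "'a \<Rightarrow> 'b::metric_space"
  assumes min: "minimal_tds X T" and fac: "factor_map X T Y S \<pi>"
    and z: "z1 \<in> X" "z2 \<in> X" "\<pi> z1 = \<pi> z2" "\<And>n. c \<le> dist ((T ^^ n) z1) ((T ^^ n) z2)"
    and x: "x \<in> X"
  obtains y where "y \<in> X" "\<pi> x = \<pi> y" "\<And>n. c \<le> dist ((T ^^ n) x) ((T ^^ n) y)"
proof -
  have fac': "continuous_on X \<pi>" "T ` X = X" "compact X" "tds X T" "\<And>x. x \<in> X \<Longrightarrow> \<pi> (T x) = S (\<pi> x)"
    using fac by (auto simp: factor_map_def tds_def)
  let ?A = "{p \<in> X \<times> X. \<forall>n\<ge>0. c \<le> dist ((T ^^ n) (fst p)) ((T ^^ n) (snd p))}"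
  let ?B = "{p \<in> X \<times> X. dist (\<pi> (fst p)) (\<pi> (snd p)) \<le> 0}"
  define E where "E = (X \<times> X) \<inter> (?A \<inter> ?B)"
  have XX: "compact (X \<times> X)" by (intro compact_Times fac')
  have "closed ?B"
    by (intro continuous_on_closed_Collect_le continuous_on_dist
        continuous_on_compose2[OF fac'(1)] continuous_intros compact_imp_closed[OF XX]) auto
  then have "compact E"
    unfolding E_def by (intro compact_Int_closed closed_Int XX closed_separated_pairs fac')
  then have "compact (fst ` E)" by (intro compact_continuous_image continuous_intros)
  moreover have "T ` fst ` E \<subseteq> fst ` E"
  proof clarsimp
    fix a b assume ab: "(a, b) \<in> E"
    have "c \<le> dist ((T ^^ n) (T a)) ((T ^^ n) (T b))" for n
      using ab by (auto simp: E_def dest!: spec[of _ "Suc n"] simp: funpow_swap1)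
    then have "(T a, T b) \<in> E" using ab fac' by (auto simp: E_def)
    then show "T a \<in> fst ` E" by force
  qed
  moreover have "(z1, z2) \<in> E" using z by (auto simp: E_def)
  moreover have "fst ` E \<subseteq> X" by (auto simp: E_def)
  ultimately have "fst ` E = X"
    by (intro minimal_closed_invariant[OF min] compact_imp_closed) auto
  then obtain y where "(x, y) \<in> E" using x by force
  then show thesis using that by (auto simp: E_def)
qed

section \<open>Block sensitivity and separated pairs in a fibre\<close>

lemma orbit_close:
  assumes "continuous_on X T" "T ` X \<subseteq> X" "x \<in> X" "r > 0"
  obtains d where "d > 0" "\<And>a j. a \<in> X \<Longrightarrow> dist a x < d \<Longrightarrow> j \<le> L \<Longrightarrow> dist ((T ^^ j) a) ((T ^^ j) x) < r"
proof -
  have "\<exists>d>0. \<forall>a\<in>X. dist a x < d \<longrightarrow> (\<forall>j<k. dist ((T ^^ j) a) ((T ^^ j) x) < r)" for k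
  proof (induction k)
    case 0 show ?case by (auto intro: exI[of _ 1])
  next
    case (Suc k)
    then obtain d where d: "d > 0" "\<forall>a\<in>X. dist a x < d \<longrightarrow> (\<forall>j<k. dist ((T ^^ j) a) ((T ^^ j) x) < r)"
      by auto
    obtain d' where d': "d' > 0" "\<forall>a\<in>X. dist a x < d' \<longrightarrow> dist ((T ^^ k) a) ((T ^^ k) x) < r"
      using continuous_on_funpow[OF assms(1,2), of k] assms(3,4) unfolding continuous_on_iff by blast
    show ?case
      using d d' by (intro exI[of _ "min d d'"]) (auto simp: less_Suc_eq)
  qed
  from this[of "Suc L"] show thesis using that by (auto simp: less_Suc_eq_le)
qed

lemma separated_fiber_imp_sensitive:
  fixes X :: "'a::metric_space set"
  assumes min: "minimal_tds X T" and max: "max_equicontinuous_factor X T Y S \<pi>"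
    and c: "c > 0"
    and z: "z1 \<in> X" "z2 \<in> X" "\<pi> z1 = \<pi> z2" "\<And>n. c \<le> dist ((T ^^ n) z1) ((T ^^ n) z2)"
  shows "block_Ft_sensitive X T"
  unfolding block_Ft_sensitive_def
proof (intro exI[of _ "c / 2"] conjI ballI allI impI)
  show "c / 2 > 0" using c by simp
  fix x U and l :: nat
  assume x: "x \<in> X" and U: "openin (top_of_set X) U \<and> x \<in> U"
  have fac: "factor_map X T Y S \<pi>" using max by (simp add: max_equicontinuous_factor_def)
  have T: "continuous_on X T" "T ` X \<subseteq> X" "compact X"
    using min by (auto simp: minimal_tds_def tds_def)
  have UX: "U \<subseteq> X" using U by (auto dest: openin_imp_subset)
  have TX: "(T ^^ n) a \<in> X" if "a \<in> X" for a n using funpow_mem[OF T(2) that] .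
  obtain y where y: "y \<in> X" "\<pi> x = \<pi> y" "\<And>n. c \<le> dist ((T ^^ n) x) ((T ^^ n) y)"
    using separated_partner[OF min fac z x] by blast
  \<comment> \<open>The orbit of \<open>{x} \<times> U\<close>: time zero puts \<open>U\<close> into
    the section at \<open>x\<close>, and one time \<open>n\<close> serves both coordinates.\<close>
  define A where "A = (\<Union>n. (\<lambda>u. ((T ^^ n) x, (T ^^ n) u)) ` U)"
  define N where "N = closure A"
  have closed_XX: "closed (X \<times> X)" by (intro closed_Times compact_imp_closed T)
  have "A \<subseteq> X \<times> X" using TX x UX by (auto simp: A_def)
  then have N_sub: "N \<subseteq> X \<times> X" unfolding N_def by (rule closure_minimal[OF _ closed_XX])
  have N_inv: "(T a, T b) \<in> N" if "(a, b) \<in> N" for a b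
  proof -
    have "(\<lambda>p. (T (fst p), T (snd p))) ` closure A \<subseteq> closure A"
    proof (rule image_closure_subset)
      show "continuous_on (closure A) (\<lambda>p. (T (fst p), T (snd p)))"
        using N_sub by (intro continuous_intros continuous_on_compose2[OF T(1)]) (auto simp: N_def)
      show "(\<lambda>p. (T (fst p), T (snd p))) ` A \<subseteq> closure A"
      proof (rule order_trans[OF _ closure_subset], clarsimp simp: A_def)
        fix n u assume "u \<in> U"
        then show "\<exists>m. (T ((T ^^ n) x), T ((T ^^ n) u)) \<in> (\<lambda>u. ((T ^^ m) x, (T ^^ m) u)) ` U"
          by (intro exI[of _ "Suc n"]) auto
      qed
    qed auto
    then show ?thesis using that by (auto simp: N_def)
  qed
  obtain d where d: "d > 0" "\<And>a j. a \<in> X \<Longrightarrow> dist a x < d \<Longrightarrow> j \<le> Suc l \<Longrightarrow>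
      dist ((T ^^ j) a) ((T ^^ j) x) < c / 8"
    using orbit_close[OF T(1,2) x, of "c / 8" "Suc l"] c by auto
  define V where "V = U \<inter> (X \<inter> ball x d)"
  have "openin (top_of_set X) V"
    unfolding V_def using U by (intro openin_Int openin_open_Int open_ball) auto
  moreover have "x \<in> V" using U x d(1) by (auto simp: V_def)
  moreover have "V \<subseteq> N `` {x}"
  proof
    fix v assume "v \<in> V"
    then have "(x, v) \<in> A" unfolding A_def V_def by (intro UN_I[of 0]) auto
    then show "v \<in> N `` {x}" using closure_subset by (auto simp: N_def)
  qed
  ultimately have "V \<inter> N `` {y} \<noteq> {}"
    using x y N_sub N_inv by (intro section_meets[OF min max, of N x y V]) (auto simp: N_def)
  then obtain b where b: "b \<in> V" "(y, b) \<in> N" by auto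
  then have bX: "b \<in> X" "dist b x < d" by (auto simp: V_def dist_commute)
  obtain d1 where d1: "d1 > 0" "\<And>a j. a \<in> X \<Longrightarrow> dist a y < d1 \<Longrightarrow> j \<le> Suc l \<Longrightarrow>
      dist ((T ^^ j) a) ((T ^^ j) y) < c / 8"
    using orbit_close[OF T(1,2) y(1), of "c / 8" "Suc l"] c by auto
  obtain d2 where d2: "d2 > 0" "\<And>a j. a \<in> X \<Longrightarrow> dist a b < d2 \<Longrightarrow> j \<le> Suc l \<Longrightarrow>
      dist ((T ^^ j) a) ((T ^^ j) b) < c / 8"
    using orbit_close[OF T(1,2) bX(1), of "c / 8" "Suc l"] c by auto
  obtain p where p: "p \<in> A" "dist p (y, b) < min d1 d2"
    using b(2) d1(1) d2(1) unfolding N_def closure_approachable by (metis min_less_iff_conj)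
  then obtain n u where nu: "u \<in> U" "p = ((T ^^ n) x, (T ^^ n) u)" by (auto simp: A_def)
  have close: "dist ((T ^^ n) x) y < d1" "dist ((T ^^ n) u) b < d2"
    using p(2) dist_fst_le[of p "(y, b)"] dist_snd_le[of p "(y, b)"] by (auto simp: nu(2))
  \<comment> \<open>The iterates of \<open>x\<close> follow \<open>y\<close>, while those of
    \<open>u\<close> follow \<open>b\<close> and hence \<open>x\<close>. Three errors below
    \<open>c / 8\<close> leave more than \<open>c / 2\<close> of the separation
    \<open>c\<close>.\<close>
  have apart: "dist ((T ^^ (j + n)) x) ((T ^^ (j + n)) u) > c / 2" if "j \<le> Suc l" for j
  proof -
    have 1: "dist ((T ^^ j) ((T ^^ n) x)) ((T ^^ j) y) < c / 8"
      by (rule d1(2)[OF TX[OF x] close(1) that])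
    have 2: "dist ((T ^^ j) ((T ^^ n) u)) ((T ^^ j) b) < c / 8"
      using nu(1) UX by (intro d2(2)[OF TX close(2) that]) auto
    have 3: "dist ((T ^^ j) b) ((T ^^ j) x) < c / 8" by (rule d(2)[OF bX that])
    have "dist ((T ^^ j) ((T ^^ n) x)) ((T ^^ j) ((T ^^ n) u)) > c / 2"
      using 1 2 3 y(3)[of j] c
        dist_triangle[of "(T ^^ j) x" "(T ^^ j) y" "(T ^^ j) b"]
        dist_triangle[of "(T ^^ j) b" "(T ^^ j) y" "(T ^^ j) ((T ^^ n) u)"]
        dist_triangle[of "(T ^^ j) ((T ^^ n) u)" "(T ^^ j) y" "(T ^^ j) ((T ^^ n) x)"]
      unfolding dist_commute[of "(T ^^ j) x" "(T ^^ j) b"]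
        dist_commute[of "(T ^^ j) b" "(T ^^ j) ((T ^^ n) u)"]
        dist_commute[of "(T ^^ j) ((T ^^ n) u)" "(T ^^ j) ((T ^^ n) x)"] by linarith
    then show ?thesis by (simp add: funpow_add)
  qed
  \<comment> \<open>The block is placed after \<open>Suc n\<close> because \<open>n\<close> may be
    zero and \<open>m\<close> must be positive; hence \<open>j\<close> had to reach
    \<open>Suc l\<close>.\<close>
  have "{Suc n + 1..Suc n + l} \<subseteq> {k. dist ((T ^^ k) x) ((T ^^ k) u) > c / 2}"
  proof
    fix k assume "k \<in> {Suc n + 1..Suc n + l}"
    then show "k \<in> {k. dist ((T ^^ k) x) ((T ^^ k) u) > c / 2}"
      using apart[of "k - n"] by auto
  qed
  then show "\<exists>y\<in>U. \<exists>m\<ge>1. {m + 1..m + l} \<subseteq> {n. c / 2 < dist ((T ^^ n) x) ((T ^^ n) y)}"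
    using nu(1) by (intro bexI[of _ u] exI[of _ "Suc n"]) auto
qed

lemma sensitive_imp_separated_fiber:
  fixes X :: "'a::metric_space set"
  assumes fac: "factor_map X T Y S \<pi>" and equi: "equicontinuous_tds Y S"
    and sens: "block_Ft_sensitive X T"
  obtains z1 z2 c where "c > 0" "z1 \<in> X" "z2 \<in> X" "\<pi> z1 = \<pi> z2"
    "\<And>n. c \<le> dist ((T ^^ n) z1) ((T ^^ n) z2)"
proof -
  obtain \<delta> where \<delta>0: "\<delta> > 0" and \<delta>1: "\<forall>x\<in>X. \<forall>U. openin (top_of_set X) U \<and> x \<in> U \<longrightarrow>
      (\<forall>l\<ge>1. \<exists>y\<in>U. \<exists>m\<ge>1. {m + 1..m + l} \<subseteq> {n. \<delta> < dist ((T ^^ n) x) ((T ^^ n) y)})"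
    using sens unfolding block_Ft_sensitive_def by (elim exE conjE) (rule that)
  have \<delta>2: "\<exists>y\<in>U. \<exists>m\<ge>1. {m + 1..m + l} \<subseteq> {n. \<delta> < dist ((T ^^ n) x) ((T ^^ n) y)}"
    if "x \<in> X" "openin (top_of_set X) U" "x \<in> U" "l \<ge> 1" for x U l
    by (rule \<delta>1[rule_format, OF that(1) conjI[OF that(2,3)] that(4)])
  have fac': "compact X" "continuous_on X \<pi>" "\<pi> ` X = Y" "T ` X = X" "X \<noteq> {}" "continuous_on X T"
    using fac by (auto simp: factor_map_def tds_def)
  have TX: "(T ^^ n) a \<in> X" if "a \<in> X" for a n using funpow_mem[of T X] fac' that by auto
  obtain x where x: "x \<in> X" using fac' by auto
  have "\<exists>a b. a \<in> X \<and> b \<in> X \<and> dist (\<pi> a) (\<pi> b) < inverse (real (Suc l)) \<and>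
      (\<forall>j\<le>l. \<delta> < dist ((T ^^ j) a) ((T ^^ j) b))" for l
  proof -
    obtain d where d: "d > 0" "\<And>y1 y2 n. y1 \<in> Y \<Longrightarrow> y2 \<in> Y \<Longrightarrow> dist y1 y2 < d \<Longrightarrow>
        dist ((S ^^ n) y1) ((S ^^ n) y2) < inverse (real (Suc l))"
      using equi unfolding equicontinuous_tds_def
      by (metis inverse_positive_iff_positive of_nat_0_less_iff zero_less_Suc)
    \<comment> \<open>Sensitivity inside this neighbourhood gives a partner whose image stays near
      that of \<open>x\<close> forever, by equicontinuity.\<close>
    have "openin (top_of_set X) (X \<inter> \<pi> -` ball (\<pi> x) d)"
      by (intro continuous_openin_preimage_gen fac') auto
    from \<delta>2[OF x this, of "Suc l"] obtain y m where y: "y \<in> X" "dist (\<pi> x) (\<pi> y) < d"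
      and m: "{m + 1..m + Suc l} \<subseteq> {n. \<delta> < dist ((T ^^ n) x) ((T ^^ n) y)}"
      using x d(1) by auto
    have "dist (\<pi> ((T ^^ Suc m) x)) (\<pi> ((T ^^ Suc m) y)) < inverse (real (Suc l))"
      unfolding factor_map_funpow[OF fac x] factor_map_funpow[OF fac y(1)]
      using x y fac' by (intro d(2)) auto
    moreover have "\<delta> < dist ((T ^^ j) ((T ^^ Suc m) x)) ((T ^^ j) ((T ^^ Suc m) y))" if "j \<le> l" for j
    proof -
      \<comment> \<open>A block of length \<open>Suc l\<close>, shifted back by
        \<open>Suc m\<close>, covers the times from 0 to \<open>l\<close>.\<close>
      have "j + Suc m \<in> {m + 1..m + Suc l}" using that by auto
      with m have "\<delta> < dist ((T ^^ (j + Suc m)) x) ((T ^^ (j + Suc m)) y)" by blast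
      then show ?thesis by (simp only: funpow_add o_apply)
    qed
    ultimately show ?thesis using TX[OF x] TX[OF y(1)] by blast
  qed
  then obtain a b where ab: "\<And>l. a l \<in> X" "\<And>l. b l \<in> X"
      "\<And>l. dist (\<pi> (a l)) (\<pi> (b l)) < inverse (real (Suc l))"
      "\<And>l j. j \<le> l \<Longrightarrow> \<delta> < dist ((T ^^ j) (a l)) ((T ^^ j) (b l))"
    by metis
  have "seq_compact (X \<times> X)" by (intro compact_imp_seq_compact compact_Times fac')
  moreover have "\<forall>n. (a n, b n) \<in> X \<times> X" using ab by auto
  ultimately obtain z r where z: "z \<in> X \<times> X" "strict_mono r" "((\<lambda>n. (a n, b n)) \<circ> r) \<longlonglongrightarrow> z"
    by (rule seq_compactE)
  obtain z1 z2 where z12: "z = (z1, z2)" by (cases z)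
  have lim: "(\<lambda>i. a (r i)) \<longlonglongrightarrow> z1" "(\<lambda>i. b (r i)) \<longlonglongrightarrow> z2"
    using tendsto_fst[OF z(3)] tendsto_snd[OF z(3)] by (auto simp: z12 o_def)
  have in_X: "z1 \<in> X" "z2 \<in> X" using z(1) z12 by auto
  have lim': "(\<lambda>i. dist (f (a (r i))) (f (b (r i)))) \<longlonglongrightarrow> dist (f z1) (f z2)"
    if "continuous_on X f" for f :: "'a \<Rightarrow> 'c::metric_space"
    using ab in_X by (intro tendsto_dist continuous_on_tendsto_compose[OF that] lim) auto
  have "dist (\<pi> z1) (\<pi> z2) \<le> 0"
  proof (rule LIMSEQ_le[OF lim'[OF fac'(2)]])
    show "(\<lambda>i. inverse (real (Suc (r i)))) \<longlonglongrightarrow> 0"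
      using LIMSEQ_subseq_LIMSEQ[OF LIMSEQ_inverse_real_of_nat z(2)] by (simp add: o_def)
  qed (use ab(3) in \<open>auto intro: less_imp_le\<close>)
  moreover have "\<delta> \<le> dist ((T ^^ n) z1) ((T ^^ n) z2)" for n
  proof (rule LIMSEQ_le_const[OF lim'[OF continuous_on_funpow]])
    show "\<exists>N. \<forall>i\<ge>N. \<delta> \<le> dist ((T ^^ n) (a (r i))) ((T ^^ n) (b (r i)))"
    proof (intro exI[of _ n] allI impI)
      fix i assume "n \<le> i"
      \<comment> \<open>For fixed \<open>n\<close> the blocks eventually reach beyond time
        \<open>n\<close>, so the bound survives in the limit, no longer strict.\<close>
      then have "n \<le> r i" using seq_suble[OF z(2), of i] by simp
      then show "\<delta> \<le> dist ((T ^^ n) (a (r i))) ((T ^^ n) (b (r i)))"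
        using ab(4)[of n "r i"] by (auto intro: less_imp_le)
    qed
  qed (use fac' in auto)
  ultimately show thesis using that[of \<delta> z1 z2] \<delta>0 in_X by auto
qed

section \<open>Proximality as a lower bound, and the three conditions\<close>

lemma INF_dist_le: "(INF n::nat. dist (f n) (g n)) \<le> dist (f n) (g n)"
  by (intro cINF_lower bdd_belowI[of _ 0]) auto

lemma not_proximal_iff: "\<not> proximal T x y \<longleftrightarrow> (\<exists>c>0. \<forall>n. c \<le> dist ((T ^^ n) x) ((T ^^ n) y))"
proof
  let ?I = "INF n. dist ((T ^^ n) x) ((T ^^ n) y)"
  assume "\<not> proximal T x y"
  moreover have "0 \<le> ?I" by (intro cINF_greatest) auto
  ultimately have "?I > 0" by (simp add: proximal_def)
  then show "\<exists>c>0. \<forall>n. c \<le> dist ((T ^^ n) x) ((T ^^ n) y)"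
    by (intro exI[of _ ?I]) (auto intro: INF_dist_le)
next
  assume "\<exists>c>0. \<forall>n. c \<le> dist ((T ^^ n) x) ((T ^^ n) y)"
  then obtain c where c: "c > 0" "\<And>n. c \<le> dist ((T ^^ n) x) ((T ^^ n) y)" by auto
  then have "c \<le> (INF n. dist ((T ^^ n) x) ((T ^^ n) y))" by (intro cINF_greatest) auto
  then show "\<not> proximal T x y" using c(1) by (simp add: proximal_def)
qed

theorem theorem4p1:
  fixes X :: "'a::metric_space set" and T :: "'a \<Rightarrow> 'a"
    and Y :: "'b::metric_space set" and S :: "'b \<Rightarrow> 'b" and \<pi> :: "'a \<Rightarrow> 'b"
  assumes "minimal_tds X T"
    and "max_equicontinuous_factor X T Y S \<pi>"
  shows "(block_Ft_sensitive X T \<longleftrightarrow>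
           (\<exists>\<delta>>0. \<forall>x\<in>X. \<exists>y\<in>X. regionally_proximal X T x y \<and>
               (INF n. dist ((T ^^ n) x) ((T ^^ n) y)) > \<delta>))
       \<and> (block_Ft_sensitive X T \<longleftrightarrow> \<not> proximal_factor_map X T \<pi>)"
proof -
  have fac: "factor_map X T Y S \<pi>" and equi: "equicontinuous_tds Y S"
    using assms(2) by (auto simp: max_equicontinuous_factor_def)
  \<comment> \<open>Each of the three conditions is compared with this one: some fibre contains a
    non-proximal pair.\<close>
  define P where "P \<longleftrightarrow> (\<exists>c>0. \<exists>z1\<in>X. \<exists>z2\<in>X. \<pi> z1 = \<pi> z2 \<and>
    (\<forall>n. c \<le> dist ((T ^^ n) z1) ((T ^^ n) z2)))"
  have one: "block_Ft_sensitive X T \<longleftrightarrow> P"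
  proof
    assume "block_Ft_sensitive X T"
    from sensitive_imp_separated_fiber[OF fac equi this] show P
      unfolding P_def by metis
  next
    assume P then show "block_Ft_sensitive X T"
      unfolding P_def using separated_fiber_imp_sensitive[OF assms] by metis
  qed
  have three: "\<not> proximal_factor_map X T \<pi> \<longleftrightarrow> P"
    unfolding proximal_factor_map_def P_def using not_proximal_iff[of T] by blast
  have two: "(\<exists>\<delta>>0. \<forall>x\<in>X. \<exists>y\<in>X. regionally_proximal X T x y \<and>
      (INF n. dist ((T ^^ n) x) ((T ^^ n) y)) > \<delta>) \<longleftrightarrow> P"
  proof
    assume "\<exists>\<delta>>0. \<forall>x\<in>X. \<exists>y\<in>X. regionally_proximal X T x y \<and>
      (INF n. dist ((T ^^ n) x) ((T ^^ n) y)) > \<delta>"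
    moreover have "X \<noteq> {}" using assms(1) by (auto simp: minimal_tds_def tds_def)
    ultimately obtain \<delta> x y where xy: "\<delta> > 0" "x \<in> X" "y \<in> X" "regionally_proximal X T x y"
      "(INF n. dist ((T ^^ n) x) ((T ^^ n) y)) > \<delta>" by blast
    have "\<delta> \<le> dist ((T ^^ n) x) ((T ^^ n) y)" for n
      using xy(5) INF_dist_le[of "\<lambda>n. (T ^^ n) x" "\<lambda>n. (T ^^ n) y" n] by simp
    then show P
      unfolding P_def using xy regionally_proximal_fiber[OF fac equi xy(2-4)] by blast
  next
    assume P
    then obtain c z1 z2 where c: "c > 0" and z: "z1 \<in> X" "z2 \<in> X" "\<pi> z1 = \<pi> z2"
      "\<And>n. c \<le> dist ((T ^^ n) z1) ((T ^^ n) z2)" unfolding P_def by blast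
    show "\<exists>\<delta>>0. \<forall>x\<in>X. \<exists>y\<in>X. regionally_proximal X T x y \<and>
      (INF n. dist ((T ^^ n) x) ((T ^^ n) y)) > \<delta>"
    \<comment> \<open>The infimum is only known to be at least \<open>c\<close>, so half of it
      secures the strict inequality.\<close>
    proof (intro exI[of _ "c / 2"] conjI ballI)
      fix x assume x: "x \<in> X"
      obtain y where y: "y \<in> X" "\<pi> x = \<pi> y" "\<And>n. c \<le> dist ((T ^^ n) x) ((T ^^ n) y)"
        using separated_partner[OF assms(1) fac z x] by blast
      have "c \<le> (INF n. dist ((T ^^ n) x) ((T ^^ n) y))" using y(3) by (intro cINF_greatest) auto
      then have "(INF n. dist ((T ^^ n) x) ((T ^^ n) y)) > c / 2" using c by linarith
      then show "\<exists>y\<in>X. regionally_proximal X T x y \<and>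
          (INF n. dist ((T ^^ n) x) ((T ^^ n) y)) > c / 2"
        using fiber_regionally_proximal[OF assms x y(1,2)] y(1) by blast
    qed (use c in simp)
  qed
  show ?thesis using one two three by simp
qed

end
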